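(* Let $\mathcal{H}_A,\mathcal{H}_B,\mathcal{H}_C$ be finite-dimensional complex Hilbert spaces, each of dimension at least $2$. For $c\in\mathbb{R}$ define the linear map on operators on $\mathcal{H}_A\otimes\mathcal{H}_B\otimes\mathcal{H}_C$ $$\Phi_T^{(c)}[\rho]=(T_A\otimes I_B\otimes I_C)[\rho]+(I_A\otimes T_B\otimes I_C)[\rho]+(I_A\otimes I_B\otimes T_C)[\rho]+c\,\mathrm{Tr}(\rho)\,\mathbb{1}.$$ Then for $c=1$ one has $\Phi_T^{(1)}[\rho]\geq 0$ for every biseparable state $\rho$ on $\mathcal{H}_A\otimes\mathcal{H}_B\otimes\mathcal{H}_C$. Moreover this value is optimal: $c=1$ is the least real number $c$ such that $\Phi_T^{(c)}[\rho]\geq 0$ for all biseparable states $\rho$.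
   Context: $T_A,T_B,T_C$ denote the transposition map on operators on the corresponding space, with respect to a fixed orthonormal basis; $I$ denotes the identity map on operators and $\mathbb{1}$ the identity operator. "$\geq 0$" means positive semidefinite. A state is a positive semidefinite operator of trace one. A tripartite state $\rho$ is biseparable if it is a finite convex combination of states, each of which is a product state $\rho_S\otimes\rho_{\bar S}$ with respect to some bipartition $S|\bar S$ of $\{A,B,C\}$ into two non-empty parts (i.e. $A|BC$, $B|AC$ or $C|AB$), where different terms may use different bipartitions and $\rho_S,\rho_{\bar S}$ are states of the subsystems in $S$ and in $\bar S$. *)

theory Defs
  imports "HOL-Analysis.Analysis"
begin

text \<open>
  Each Hilbert space is identified with a coordinate space \<^typ>\<open>complex ^ 'n\<close> by means of the
  orthonormal basis that defines the transposition; operators are then square matrices. The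
  tensor product of the spaces indexed by \<open>'a\<close>, \<open>'b\<close>, \<open>'c\<close> is indexed by
  \<^typ>\<open>'a \<times> 'b \<times> 'c\<close>, its basis vectors being the products of basis vectors.
\<close>

type_synonym 'n operator = "complex ^ 'n ^ 'n"

definition psd :: "'n::finite operator \<Rightarrow> bool" where
  "psd M \<longleftrightarrow> map_matrix cnj (transpose M) = M \<and>
     (\<forall>v :: complex ^ 'n. 0 \<le> Re (\<Sum>i\<in>UNIV. cnj (v $ i) * (M *v v) $ i))"

definition state :: "'n::finite operator \<Rightarrow> bool" where
  "state M \<longleftrightarrow> psd M \<and> trace M = 1"

definition tensor :: "'m::finite operator \<Rightarrow> 'n::finite operator \<Rightarrow> ('m \<times> 'n) operator" where
  "tensor M N = (\<chi> i j. M $ fst i $ fst j * N $ snd i $ snd j)"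

definition product_A_BC :: "('a::finite \<times> 'b::finite \<times> 'c::finite) operator \<Rightarrow> bool" where
  "product_A_BC \<rho> \<longleftrightarrow> (\<exists>(\<sigma> :: 'a operator) (\<tau> :: ('b \<times> 'c) operator). state \<sigma> \<and> state \<tau> \<and>
     \<rho> = tensor \<sigma> \<tau>)"

text \<open>
  For the other two bipartitions the factors of the tensor product have to be brought
  into the order \<open>A\<close>, \<open>B\<close>, \<open>C\<close>.
\<close>

definition product_B_AC :: "('a::finite \<times> 'b::finite \<times> 'c::finite) operator \<Rightarrow> bool" where
  "product_B_AC \<rho> \<longleftrightarrow> (\<exists>(\<sigma> :: 'b operator) (\<tau> :: ('a \<times> 'c) operator). state \<sigma> \<and> state \<tau> \<and>
     \<rho> = (\<chi> i j. case (i, j) of ((a, b, c), (a', b', c')) \<Rightarrow>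
            tensor \<sigma> \<tau> $ (b, (a, c)) $ (b', (a', c'))))"

definition product_C_AB :: "('a::finite \<times> 'b::finite \<times> 'c::finite) operator \<Rightarrow> bool" where
  "product_C_AB \<rho> \<longleftrightarrow> (\<exists>(\<sigma> :: 'c operator) (\<tau> :: ('a \<times> 'b) operator). state \<sigma> \<and> state \<tau> \<and>
     \<rho> = (\<chi> i j. case (i, j) of ((a, b, c), (a', b', c')) \<Rightarrow>
            tensor \<sigma> \<tau> $ (c, (a, b)) $ (c', (a', b'))))"

definition biseparable :: "('a::finite \<times> 'b::finite \<times> 'c::finite) operator \<Rightarrow> bool" where
  "biseparable \<rho> \<longleftrightarrow> (\<exists>(n::nat) (p :: nat \<Rightarrow> real) (\<sigma> :: nat \<Rightarrow> ('a \<times> 'b \<times> 'c) operator).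
     (\<forall>k<n. 0 \<le> p k \<and>
        (product_A_BC (\<sigma> k) \<or> product_B_AC (\<sigma> k) \<or> product_C_AB (\<sigma> k))) \<and>
     (\<Sum>k<n. p k) = 1 \<and>
     \<rho> = (\<Sum>k<n. p k *\<^sub>R \<sigma> k))"

text \<open>
  The maps \<open>T\<^sub>A \<otimes> I\<^sub>B \<otimes> I\<^sub>C\<close>, \<open>I\<^sub>A \<otimes> T\<^sub>B \<otimes> I\<^sub>C\<close> and \<open>I\<^sub>A \<otimes> I\<^sub>B \<otimes> T\<^sub>C\<close>, entrywise: the row and
  column index of one subsystem are exchanged. They are linear, and the lemmas \<open>pt_A_tensor\<close>,
  \<open>pt_B_tensor\<close> and \<open>pt_C_tensor\<close> give their values on product operators, which determines them.
\<close>

definition pt_A :: "('a::finite \<times> 'b::finite \<times> 'c::finite) operator \<Rightarrow> ('a \<times> 'b \<times> 'c) operator" where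
  "pt_A \<rho> = (\<chi> i j. case (i, j) of ((a, b, c), (a', b', c')) \<Rightarrow> \<rho> $ (a', b, c) $ (a, b', c'))"

definition pt_B :: "('a::finite \<times> 'b::finite \<times> 'c::finite) operator \<Rightarrow> ('a \<times> 'b \<times> 'c) operator" where
  "pt_B \<rho> = (\<chi> i j. case (i, j) of ((a, b, c), (a', b', c')) \<Rightarrow> \<rho> $ (a, b', c) $ (a', b, c'))"

definition pt_C :: "('a::finite \<times> 'b::finite \<times> 'c::finite) operator \<Rightarrow> ('a \<times> 'b \<times> 'c) operator" where
  "pt_C \<rho> = (\<chi> i j. case (i, j) of ((a, b, c), (a', b', c')) \<Rightarrow> \<rho> $ (a, b, c') $ (a', b', c))"

lemma pt_A_tensor: "pt_A (tensor X (tensor Y Z)) = tensor (transpose X) (tensor Y Z)"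
  by (simp add: vec_eq_iff pt_A_def tensor_def transpose_def split: prod.splits)

lemma pt_B_tensor: "pt_B (tensor X (tensor Y Z)) = tensor X (tensor (transpose Y) Z)"
  by (simp add: vec_eq_iff pt_B_def tensor_def transpose_def split: prod.splits)

lemma pt_C_tensor: "pt_C (tensor X (tensor Y Z)) = tensor X (tensor Y (transpose Z))"
  by (simp add: vec_eq_iff pt_C_def tensor_def transpose_def split: prod.splits)

text \<open>\<^term>\<open>mat z\<close> is the scalar multiple \<open>z \<one>\<close> of the identity matrix.\<close>

definition \<Phi>\<^sub>T ::
  "real \<Rightarrow> ('a::finite \<times> 'b::finite \<times> 'c::finite) operator \<Rightarrow> ('a \<times> 'b \<times> 'c) operator" where
  "\<Phi>\<^sub>T c \<rho> = pt_A \<rho> + pt_B \<rho> + pt_C \<rho> + mat (complex_of_real c * trace \<rho>)"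

end

theory Submission
  imports Defs
begin

text \<open>
  For a product operator \<open>\<sigma> \<otimes> \<tau>\<close> the value of the map splits into three positive parts:
  \<open>\<sigma>\<^sup>T \<otimes> \<tau>\<close>, then \<open>\<sigma> \<otimes> (X + X\<^sup>T)\<close> with \<open>X\<close> the partial transpose of \<open>\<tau>\<close> plus
  \<open>(Tr \<tau> / 2) \<one>\<close>, and \<open>(Tr \<sigma> \<one> - \<sigma>) \<otimes> (Tr \<tau>) \<one>\<close>. So everything rests on the fact that the
  eigenvalues of the partial transpose of a state are at least \<open>-1/2\<close>.
  The bound is attained at the maximally entangled state of two qubits by the antisymmetric
  vector, for both partial transposes at once, which makes \<open>c = 1\<close> optimal.
\<close>

subsection \<open>Sesquilinear forms and positive semidefinite matrices\<close>

definition sesq :: "'n::finite operator \<Rightarrow> complex ^ 'n \<Rightarrow> complex ^ 'n \<Rightarrow> complex" where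
  "sesq M u v = (\<Sum>i\<in>UNIV. cnj (u $ i) * (M *v v) $ i)"

definition outer :: "complex ^ 'n::finite \<Rightarrow> 'n operator" where
  "outer x = (\<chi> i j. x $ i * cnj (x $ j))"

lemma psd_iff: "psd M \<longleftrightarrow> (\<forall>i j. cnj (M $ j $ i) = M $ i $ j) \<and> (\<forall>v. 0 \<le> Re (sesq M v v))"
  by (auto simp: psd_def sesq_def vec_eq_iff map_matrix_def transpose_def)

lemma psd_hermitian: "psd M \<Longrightarrow> cnj (M $ j $ i) = M $ i $ j"
  by (simp add: psd_iff)

lemma psd_nonneg: "psd M \<Longrightarrow> 0 \<le> Re (sesq M v v)"
  by (simp add: psd_iff)

lemma sesq_expand: "sesq M u v = (\<Sum>i\<in>UNIV. \<Sum>j\<in>UNIV. cnj (u $ i) * M $ i $ j * v $ j)"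
  by (simp add: sesq_def matrix_vector_mult_def sum_distrib_left mult.assoc)

lemma sesq_diff_left: "sesq M (u - u') v = sesq M u v - sesq M u' v"
  by (simp add: sesq_def sum_subtractf algebra_simps)

lemma sesq_diff_right: "sesq M u (v - v') = sesq M u v - sesq M u v'"
  by (simp add: sesq_def sum_subtractf algebra_simps matrix_vector_mult_diff_distrib)

lemma sesq_matrix_add: "sesq (M + N) u v = sesq M u v + sesq N u v"
  by (simp add: sesq_def sum.distrib algebra_simps matrix_vector_mult_add_rdistrib)

lemma sesq_matrix_diff: "sesq (M - N) u v = sesq M u v - sesq N u v"
  by (simp add: sesq_expand sum_subtractf algebra_simps)

lemma sesq_matrix_scaleR: "sesq (r *\<^sub>R M) u v = r *\<^sub>R sesq M u v"
  by (simp add: sesq_expand scaleR_sum_right algebra_simps)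

lemma sesq_axis_left: "sesq M (axis i a) v = cnj a * (M *v v) $ i"
proof -
  have "sesq M (axis i a) v = (\<Sum>k\<in>UNIV. if k = i then cnj a * (M *v v) $ k else 0)"
    unfolding sesq_def by (rule sum.cong) (auto simp: axis_def)
  then show ?thesis by simp
qed

lemma matrix_vector_axis: "((M :: 'n::finite operator) *v axis j b) $ i = M $ i $ j * b"
proof -
  have "(M *v axis j b) $ i = (\<Sum>k\<in>UNIV. if k = j then M $ i $ k * b else 0)"
    unfolding matrix_vector_mult_def vec_lambda_beta by (rule sum.cong) (auto simp: axis_def)
  then show ?thesis by simp
qed

text \<open>\<open>outer x\<close> is the projector-like |x><x|, so its form factors through the
  inner products with \<open>x\<close>; at equal arguments this is a squared modulus.\<close>

lemma sesq_outer: "sesq (outer x) u v = cnj (\<Sum>i\<in>UNIV. cnj (x $ i) * u $ i) * (\<Sum>i\<in>UNIV. cnj (x $ i) * v $ i)"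
proof -
  have "sesq (outer x) u v = (\<Sum>i\<in>UNIV. \<Sum>j\<in>UNIV. (x $ i * cnj (u $ i)) * (cnj (x $ j) * v $ j))"
    by (simp add: sesq_expand outer_def mult_ac)
  then show ?thesis by (simp flip: sum_product)
qed

lemma norm_vec_power2: "(norm v)\<^sup>2 = (\<Sum>i\<in>UNIV. (norm (v $ i))\<^sup>2)"
  by (simp add: norm_vec_def L2_set_def sum_nonneg)

lemma sesq_mat: "sesq (mat z) v v = z * of_real ((norm v)\<^sup>2)"
proof -
  have "sesq (mat z) v v = (\<Sum>i\<in>UNIV. z * of_real ((cmod (v $ i))\<^sup>2))"
    unfolding sesq_expand mat_def
    by (rule sum.cong) (auto simp: if_distrib if_distribR complex_norm_square mult_ac
        simp del: of_real_power cong: if_cong)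
  then show ?thesis by (simp add: norm_vec_power2 sum_distrib_left)
qed

lemma psd_outer: "psd (outer x)"
proof -
  have "0 \<le> Re (cnj z * z)" for z
    by simp
  then show ?thesis
    unfolding psd_iff sesq_outer by (simp only: outer_def) (simp add: mult.commute)
qed

lemma psd_add: "psd M \<Longrightarrow> psd N \<Longrightarrow> psd (M + N)"
  by (simp add: psd_iff sesq_matrix_add)

lemma psd_scaleR: "0 \<le> r \<Longrightarrow> psd M \<Longrightarrow> psd (r *\<^sub>R M)"
  by (simp add: psd_iff sesq_matrix_scaleR)

lemma psd_zero: "psd 0"
  by (simp add: psd_iff sesq_expand)

lemma psd_sum: "(\<And>k. k \<in> K \<Longrightarrow> psd (M k)) \<Longrightarrow> psd (sum M K)"
  by (induction K rule: infinite_finite_induct) (auto simp: psd_zero psd_add)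

lemma psd_transpose:
  assumes "psd M" shows "psd (transpose M)"
proof -
  have "sesq (transpose M) v v = sesq M (\<chi> i. cnj (v $ i)) (\<chi> i. cnj (v $ i))" for v
    unfolding sesq_expand
    by (subst sum.swap) (simp add: transpose_def mult_ac)
  with assms show ?thesis
    by (simp add: psd_iff) (simp add: transpose_def)
qed

lemma sum_UNIV_prod: "(\<Sum>i\<in>(UNIV :: ('a::finite \<times> 'b::finite) set). f i) = (\<Sum>a\<in>UNIV. \<Sum>b\<in>UNIV. f (a, b))"
  by (simp add: sum.cartesian_product)

lemma sum_UNIV_bij:
  assumes "bij f" shows "(\<Sum>i\<in>UNIV. g (f i)) = (\<Sum>i\<in>UNIV. g i)"
  using sum.reindex_bij_betw[OF assms] .

text \<open>Relabelling the basis is conjugation by a permutation unitary. This carries positivity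
  from A|BC over to the other two bipartitions.\<close>

lemma psd_reindex:
  fixes M :: "'n::finite operator" and f :: "'m::finite \<Rightarrow> 'n"
  assumes "bij f" "psd M" shows "psd (\<chi> i j. M $ f i $ f j)"
proof -
  have "sesq (\<chi> i j. M $ f i $ f j) v v = sesq M (\<chi> i. v $ inv f i) (\<chi> i. v $ inv f i)" for v
    unfolding sesq_expand sum_UNIV_bij[OF assms(1), symmetric]
    using assms(1) by (simp add: bij_is_inj inv_f_f)
  with assms(2) show ?thesis
    by (simp add: psd_iff)
qed

section \<open>Diagonal entries and decomposition into rank-one matrices\<close>

lemma psd_diagonal:
  assumes "psd M" shows "M $ i $ i = of_real (Re (M $ i $ i))" "0 \<le> Re (M $ i $ i)"
proof -
  have "cnj (M $ i $ i) = M $ i $ i" using assms by (rule psd_hermitian)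
  then show "M $ i $ i = of_real (Re (M $ i $ i))"
    by (metis Reals_cnj_iff of_real_Re)
  show "0 \<le> Re (M $ i $ i)"
    using psd_nonneg[OF assms, of "axis i 1"] by (simp add: sesq_axis_left matrix_vector_axis)
qed

lemma sesq_axis_right:
  assumes "psd M" shows "sesq M v (axis k t) = cnj ((M *v v) $ k) * t"
  unfolding sesq_def matrix_vector_axis
  by (simp add: matrix_vector_mult_def sum_distrib_left sum_distrib_right psd_hermitian[OF assms] mult_ac)

text \<open>If the entry were nonzero, the form at e_j - t M_ij e_i would be affine in t with slope
  -2 |M_ij|^2, hence negative for large t.\<close>

lemma psd_zero_diagonal:
  assumes "psd M" "M $ i $ i = 0" shows "M $ i $ j = 0"
proof (rule ccontr)
  assume "M $ i $ j \<noteq> 0"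
  then have pos: "(cmod (M $ i $ j))\<^sup>2 > 0" by simp
  \<comment> \<open>Chosen so that the form takes the value -1 exactly.\<close>
  define t where "t = (Re (M $ j $ j) + 1) / (2 * (cmod (M $ i $ j))\<^sup>2)"
  define v where "v = axis j 1 - axis i (of_real t * M $ i $ j)"
  have ji: "M $ j $ i = cnj (M $ i $ j)"
    by (simp add: psd_hermitian[OF assms(1)])
  have "sesq M v v = M $ j $ j - 2 * of_real t * of_real ((cmod (M $ i $ j))\<^sup>2)"
    unfolding v_def sesq_diff_left sesq_diff_right sesq_axis_left matrix_vector_axis
    unfolding vector_minus_component matrix_vector_mult_diff_distrib matrix_vector_axis ji
      complex_norm_square assms(2)
    by (simp add: algebra_simps)
  then have "Re (sesq M v v) = Re (M $ j $ j) - 2 * t * (cmod (M $ i $ j))\<^sup>2" by simp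
  also have "\<dots> = - 1" using pos by (simp add: t_def field_simps)
  finally show False using psd_nonneg[OF assms(1), of v] by simp
qed

text \<open>Every positive semidefinite matrix is a sum of rank-one ones. The induction step is the
  Schur complement with respect to a nonzero diagonal entry.\<close>

lemma psd_induct [consumes 1, case_names outer add]:
  assumes "psd M"
    and outer: "\<And>x. P (outer x)"
    and add: "\<And>M N. psd M \<Longrightarrow> psd N \<Longrightarrow> P M \<Longrightarrow> P N \<Longrightarrow> P (M + N)"
  shows "P M"
  using assms(1)
proof (induction "card {i. M $ i $ i \<noteq> 0}" arbitrary: M rule: less_induct)
  case less
  show ?case
  proof (cases "\<forall>k. M $ k $ k = 0")
    case True
    then have "M = outer 0"
      using psd_zero_diagonal[OF less.prems] by (simp add: vec_eq_iff outer_def)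
    then show ?thesis using outer by simp
  next
    case False
    then obtain k where k: "M $ k $ k \<noteq> 0" by blast
    define d where "d = Re (M $ k $ k)"
    have d: "M $ k $ k = of_real d" "d > 0"
      using psd_diagonal[OF less.prems, of k] k unfolding d_def
      by (auto simp: order.order_iff_strict)
    \<comment> \<open>Column \<open>k\<close>, scaled so that \<open>outer x\<close> agrees with
      \<open>M\<close> on the whole of row and column \<open>k\<close>; \<open>N\<close> below is
      the Schur complement padded with zeros.\<close>
    define x where "x = (\<chi> i. M $ i $ k / of_real (sqrt d))"
    have sq: "complex_of_real (sqrt d) * of_real (sqrt d) = of_real d"
      using d(2) by (simp flip: of_real_mult)
    have out: "outer x $ i $ j = M $ i $ k * M $ k $ j / of_real d" for i j
      using psd_hermitian[OF less.prems, of j k] by (simp add: outer_def x_def sq)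
    have x_inner: "(\<Sum>i\<in>UNIV. cnj (x $ i) * v $ i) = (M *v v) $ k / of_real (sqrt d)" for v
      by (simp add: x_def matrix_vector_mult_def sum_divide_distrib psd_hermitian[OF less.prems])
    define N where "N = M - outer x"
    have "psd N"
      unfolding psd_iff
    proof (intro conjI allI)
      show "cnj (N $ j $ i) = N $ i $ j" for i j
        unfolding N_def using psd_hermitian[OF less.prems] psd_hermitian[OF psd_outer[of x]] by simp
      show "0 \<le> Re (sesq N v v)" for v
      proof -
        let ?m = "(M *v v) $ k"
        let ?t = "?m / of_real d"
        \<comment> \<open>Completing the square: shifting \<open>v\<close> along e_k to the minimum
          of the form of \<open>M\<close> leaves exactly the form of \<open>N\<close> at
          \<open>v\<close>.\<close>
        have "sesq M (v - axis k ?t) (v - axis k ?t)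
            = sesq M v v - cnj ?m * ?m / of_real d"
          unfolding sesq_diff_left sesq_diff_right sesq_axis_left matrix_vector_axis
            sesq_axis_right[OF less.prems] d(1)
          using d(2) by simp
        also have "\<dots> = sesq N v v"
          unfolding N_def sesq_matrix_diff sesq_outer x_inner using sq by simp
        finally show ?thesis using psd_nonneg[OF less.prems] by metis
      qed
    qed
    \<comment> \<open>The measure drops: where \<open>M\<close> has a zero diagonal entry its row
      vanishes, so \<open>N\<close> has a zero there too, and entry \<open>k\<close> is a new
      zero.\<close>
    have "{i. N $ i $ i \<noteq> 0} \<subset> {i. M $ i $ i \<noteq> 0}"
    proof
      show "{i. N $ i $ i \<noteq> 0} \<subseteq> {i. M $ i $ i \<noteq> 0}"
        using psd_zero_diagonal[OF less.prems] by (auto simp: N_def out)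
      show "{i. N $ i $ i \<noteq> 0} \<noteq> {i. M $ i $ i \<noteq> 0}"
        using k d by (auto simp: N_def out set_eq_iff intro!: exI[of _ k])
    qed
    then have "P N"
      using less.hyps \<open>psd N\<close> by (simp add: psubset_card_mono)
    then have "P (outer x + N)"
      using add outer psd_outer \<open>psd N\<close> by blast
    then show ?thesis by (simp add: N_def)
  qed
qed

section \<open>Traces and the Cauchy-Schwarz inequality\<close>

lemma trace_outer: "trace (outer x) = of_real ((norm x)\<^sup>2)"
  unfolding trace_def outer_def norm_vec_power2 of_real_sum complex_norm_square by simp

lemma trace_psd_real:
  assumes "psd M" shows "trace M \<in> \<real>"
proof -
  have "M $ i $ i \<in> \<real>" for i
    using psd_hermitian[OF assms, of i i] by (simp add: Reals_cnj_iff)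
  then show ?thesis unfolding trace_def by (rule sum_in_Reals)
qed

lemma inner_product_bound:
  fixes x y :: "complex ^ 'n::finite"
  shows "cmod (\<Sum>i\<in>UNIV. x $ i * y $ i) \<le> norm x * norm y"
proof -
  have "cmod (\<Sum>i\<in>UNIV. x $ i * y $ i) \<le> (\<Sum>i\<in>UNIV. \<bar>cmod (x $ i)\<bar> * \<bar>cmod (y $ i)\<bar>)"
    by (rule sum_norm_le) (simp add: norm_mult)
  also have "\<dots> \<le> norm x * norm y"
    unfolding norm_vec_def by (rule L2_set_mult_ineq)
  finally show ?thesis .
qed

lemma mat_add: "mat (z + w) = mat z + (mat w :: 'n::finite operator)"
  by (simp add: mat_def vec_eq_iff)

text \<open>Positivity of the reduction map: for rank one it is the Cauchy-Schwarz inequality, and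
  the expression is additive in \<open>M\<close>.\<close>

lemma psd_trace_minus:
  assumes "psd M" shows "psd (mat (trace M) - M)"
  using assms
proof (induction rule: psd_induct)
  case (outer x)
  have "0 \<le> Re (sesq (mat (trace (outer x)) - outer x) v v)" for v
  proof -
    let ?s = "\<Sum>i\<in>UNIV. cnj (x $ i) * v $ i"
    have "cmod ?s \<le> norm x * norm v"
      using inner_product_bound[of "\<chi> i. cnj (x $ i)" v] by (simp add: norm_vec_def)
    then have "(cmod ?s)\<^sup>2 \<le> (norm x)\<^sup>2 * (norm v)\<^sup>2"
      by (metis norm_ge_zero power_mono power_mult_distrib)
    moreover have "cnj ?s * ?s = of_real ((cmod ?s)\<^sup>2)"
      unfolding complex_norm_square by (simp only: mult.commute)
    ultimately show ?thesis
      by (simp only: sesq_matrix_diff sesq_mat sesq_outer trace_outer flip: of_real_mult of_real_diff) simp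
  qed
  then show ?case
    unfolding psd_iff using trace_psd_real[OF psd_outer[of x]]
    by (auto simp: mat_def outer_def Reals_cnj_iff)
next
  case (add M N)
  then have "psd ((mat (trace M) - M) + (mat (trace N) - N))" by (intro psd_add)
  then show ?case by (simp add: trace_add mat_add algebra_simps)
qed

subsection \<open>Tensor products and partial transposition\<close>

lemma tensor_add_left: "tensor (M + M') N = tensor M N + tensor M' N"
  by (simp add: tensor_def vec_eq_iff algebra_simps)

text \<open>Decomposing the left factor suffices: for |x><x| the form at \<open>v\<close> is the
  form of \<open>N\<close> at the partial inner product of \<open>x\<close> with
  \<open>v\<close>.\<close>

lemma psd_tensor:
  assumes "psd M" "psd N" shows "psd (tensor M N)"
  using assms(1)
proof (induction rule: psd_induct)
  case (outer x)
  have "sesq (tensor (outer x) N) v v = sesq N w w"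
    if "w = (\<chi> j. \<Sum>i\<in>UNIV. cnj (x $ i) * v $ (i, j))" for v w
  proof -
    have "sesq (tensor (outer x) N) v v = (\<Sum>i\<in>UNIV. \<Sum>j\<in>UNIV. \<Sum>i'\<in>UNIV. \<Sum>j'\<in>UNIV.
        cnj (v $ (i, j)) * x $ i * N $ j $ j' * (cnj (x $ i') * v $ (i', j')))"
      by (simp add: sesq_expand sum_UNIV_prod tensor_def outer_def mult_ac)
    also have "\<dots> = (\<Sum>j\<in>UNIV. \<Sum>i\<in>UNIV. \<Sum>j'\<in>UNIV. \<Sum>i'\<in>UNIV.
        cnj (v $ (i, j)) * x $ i * N $ j $ j' * (cnj (x $ i') * v $ (i', j')))"
      by (subst sum.swap) (intro sum.cong refl sum.swap)
    also have "\<dots> = (\<Sum>j\<in>UNIV. \<Sum>j'\<in>UNIV. \<Sum>i\<in>UNIV. \<Sum>i'\<in>UNIV.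
        cnj (v $ (i, j)) * x $ i * N $ j $ j' * (cnj (x $ i') * v $ (i', j')))"
      by (intro sum.cong refl sum.swap)
    also have "\<dots> = sesq N w w"
      unfolding sesq_expand that
      by (simp add: sum_distrib_left sum_distrib_right mult_ac)
    finally show ?thesis .
  qed
  moreover have "cnj (tensor (outer x) N $ j $ i) = tensor (outer x) N $ i $ j" for i j
    using psd_hermitian[OF psd_outer[of x]] psd_hermitian[OF assms(2)] by (simp add: tensor_def)
  ultimately show ?case
    unfolding psd_iff using psd_nonneg[OF assms(2)] by simp
next
  case (add M M')
  then show ?case by (simp add: tensor_add_left psd_add)
qed

text \<open>The first factor is transposed; the transpose of the result is the partial transpose on
  the second factor.\<close>

definition partial_transpose :: "('b::finite \<times> 'c::finite) operator \<Rightarrow> ('b \<times> 'c) operator" where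
  "partial_transpose \<tau> = (\<chi> i j. \<tau> $ (fst j, snd i) $ (fst i, snd j))"

text \<open>Lagrange's identity: the left side equals the right side minus 2 |<w, p>|^2.\<close>

lemma norm_wedge_bound:
  fixes p w :: "complex ^ 'c::finite"
  shows "(norm (\<chi> c c'. p $ c * w $ c' - p $ c' * w $ c))\<^sup>2 \<le> 2 * (norm p)\<^sup>2 * (norm w)\<^sup>2"
proof -
  let ?s = "\<Sum>c\<in>UNIV. p $ c * cnj (w $ c)"
  let ?P = "\<Sum>c\<in>UNIV. p $ c * cnj (p $ c)"
  let ?W = "\<Sum>c\<in>UNIV. w $ c * cnj (w $ c)"
  have "complex_of_real ((norm (\<chi> c c'. p $ c * w $ c' - p $ c' * w $ c))\<^sup>2)
     = (\<Sum>c\<in>UNIV. \<Sum>c'\<in>UNIV. (p $ c * cnj (p $ c)) * (w $ c' * cnj (w $ c')))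
     + (\<Sum>c\<in>UNIV. \<Sum>c'\<in>UNIV. (w $ c * cnj (w $ c)) * (p $ c' * cnj (p $ c')))
     - (\<Sum>c\<in>UNIV. \<Sum>c'\<in>UNIV. (p $ c * cnj (w $ c)) * (w $ c' * cnj (p $ c')))
     - (\<Sum>c\<in>UNIV. \<Sum>c'\<in>UNIV. (w $ c * cnj (p $ c)) * (p $ c' * cnj (w $ c')))"
    unfolding norm_vec_power2 of_real_sum vec_lambda_beta complex_norm_square
      sum.distrib[symmetric] sum_subtractf[symmetric]
    by (intro sum.cong refl) (simp add: algebra_simps)
  also have "\<dots> = ?P * ?W + ?W * ?P - ?s * cnj ?s - cnj ?s * ?s"
    unfolding sum_product[symmetric] by (simp add: mult.commute)
  also have "\<dots> = 2 * ?P * ?W - 2 * (?s * cnj ?s)"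
    by (simp only: mult.commute[of ?W] mult.commute[of "cnj ?s"] mult_2 diff_diff_eq distrib_right)
  also have "\<dots> = of_real (2 * (norm p)\<^sup>2 * (norm w)\<^sup>2 - 2 * (cmod ?s)\<^sup>2)"
    unfolding norm_vec_power2 of_real_diff of_real_mult of_real_sum complex_norm_square
    by (simp only: of_real_numeral)
  finally show ?thesis
    unfolding of_real_eq_iff by simp
qed

text \<open>For a rank-one \<open>\<tau>\<close> the quadratic form of the partial transpose is the sum of
  \<open>M c c' * cnj (M c' c)\<close>, the squared Frobenius norm of the symmetric part of \<open>M\<close> minus that of the
  antisymmetric part \<open>D/2\<close>. The latter is a sum of wedge products, one for each row.\<close>

lemma psd_partial_transpose:
  fixes \<tau> :: "('b::finite \<times> 'c::finite) operator"
  assumes "psd \<tau>" shows "psd (partial_transpose \<tau> + mat (trace \<tau> / 2))"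
  using assms
proof (induction rule: psd_induct)
  case (outer x)
  have "0 \<le> Re (sesq (partial_transpose (outer x) + mat (trace (outer x) / 2)) v v)" for v :: "complex ^ ('b \<times> 'c)"
  proof -
    \<comment> \<open>\<open>x\<close> and \<open>v\<close> are read as matrices with rows
      \<open>p b\<close> and \<open>w b\<close>, so that \<open>M\<close> is the sum of the products
      p_b w_b^T.\<close>
    define p where "p b = (\<chi> c. x $ (b, c))" for b
    define w where "w b = (\<chi> c. v $ (b, c))" for b
    define M where "M c c' = (\<Sum>b\<in>UNIV. p b $ c * w b $ c')" for c c'
    define D :: "'b \<Rightarrow> complex ^ 'c ^ 'c" where "D b = (\<chi> c c'. p b $ c * w b $ c' - p b $ c' * w b $ c)" for b
    have L2: "L2_set (\<lambda>b. norm (\<chi> c. y $ (b, c))) UNIV = norm y" for y :: "complex ^ ('b \<times> 'c)"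
      by (simp add: norm_vec_def L2_set_def sum_nonneg sum_UNIV_prod)
    have "norm (D b) \<le> sqrt 2 * (norm (p b) * norm (w b))" for b
      using real_le_rsqrt[OF norm_wedge_bound[of "p b" "w b"]]
      by (simp add: D_def real_sqrt_mult mult.assoc)
    \<comment> \<open>The triangle inequality over the rows, then Cauchy-Schwarz over
      \<open>b\<close>, recovers the full norms of \<open>x\<close> and \<open>v\<close>.\<close>
    then have "norm (sum D UNIV) \<le> sqrt 2 * (\<Sum>b\<in>UNIV. \<bar>norm (p b)\<bar> * \<bar>norm (w b)\<bar>)"
      unfolding sum_distrib_left by (intro sum_norm_le) simp
    also have "\<dots> \<le> sqrt 2 * (norm x * norm v)"
      using L2_set_mult_ineq[of "\<lambda>b. norm (p b)" "\<lambda>b. norm (w b)" UNIV]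
      by (simp add: p_def w_def L2)
    finally have "(norm (sum D UNIV))\<^sup>2 \<le> (sqrt 2 * (norm x * norm v))\<^sup>2"
      by (intro power_mono) auto
    then have D: "(norm (sum D UNIV))\<^sup>2 \<le> 2 * ((norm x)\<^sup>2 * (norm v)\<^sup>2)"
      by (simp add: power_mult_distrib)
    have "sum D UNIV $ c $ c' = M c c' - M c' c" for c c'
      by (simp add: D_def M_def sum_subtractf mult_ac)
    then have D_eq: "(norm (sum D UNIV))\<^sup>2 = (\<Sum>c\<in>UNIV. \<Sum>c'\<in>UNIV. (cmod (M c c' - M c' c))\<^sup>2)"
      unfolding norm_vec_power2 by simp
    \<comment> \<open>From 4 Re (a cnj b) = |a + b|^2 - |a - b|^2 by dropping the symmetric
      part.\<close>
    have polar: "- (cmod (a - b))\<^sup>2 / 4 \<le> Re (a * cnj b)" for a b :: complex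
      using zero_le_power2[of "Re a + Re b"] zero_le_power2[of "Im a + Im b"]
      unfolding cmod_power2 unfolding power2_eq_square by (simp add: algebra_simps)
    \<comment> \<open>The partial transpose swaps the row labels of the two copies of
      \<open>x\<close>, so each copy now shares its row with a copy of \<open>v\<close> and the sums
      over \<open>b\<close> and \<open>b'\<close> separate.\<close>
    have "sesq (partial_transpose (outer x)) v v = (\<Sum>b\<in>UNIV. \<Sum>c\<in>UNIV. \<Sum>b'\<in>UNIV. \<Sum>c'\<in>UNIV.
        (p b' $ c * w b' $ c') * cnj (p b $ c' * w b $ c))"
      by (simp add: sesq_expand sum_UNIV_prod partial_transpose_def outer_def p_def w_def mult_ac)
    also have "\<dots> = (\<Sum>c\<in>UNIV. \<Sum>b\<in>UNIV. \<Sum>c'\<in>UNIV. \<Sum>b'\<in>UNIV.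
        (p b' $ c * w b' $ c') * cnj (p b $ c' * w b $ c))"
      by (subst sum.swap) (intro sum.cong refl sum.swap)
    also have "\<dots> = (\<Sum>c\<in>UNIV. \<Sum>c'\<in>UNIV. \<Sum>b\<in>UNIV. \<Sum>b'\<in>UNIV.
        (p b' $ c * w b' $ c') * cnj (p b $ c' * w b $ c))"
      by (intro sum.cong refl sum.swap)
    also have "\<dots> = (\<Sum>c\<in>UNIV. \<Sum>c'\<in>UNIV. M c c' * cnj (M c' c))"
      unfolding M_def by (simp add: sum_distrib_left sum_distrib_right)
    finally have "Re (sesq (partial_transpose (outer x)) v v) = (\<Sum>c\<in>UNIV. \<Sum>c'\<in>UNIV. Re (M c c' * cnj (M c' c)))"
      by simp
    also have "\<dots> \<ge> (\<Sum>c\<in>UNIV. \<Sum>c'\<in>UNIV. - (cmod (M c c' - M c' c))\<^sup>2 / 4)"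
      by (intro sum_mono polar)
    also have "(\<Sum>c\<in>UNIV. \<Sum>c'\<in>UNIV. - (cmod (M c c' - M c' c))\<^sup>2 / 4) = - (norm (sum D UNIV))\<^sup>2 / 4"
      unfolding D_eq by (simp add: sum_negf sum_divide_distrib)
    finally have "Re (sesq (partial_transpose (outer x)) v v) \<ge> - (norm (sum D UNIV))\<^sup>2 / 4" .
    moreover have "Re (sesq (mat (trace (outer x) / 2)) v v) = (norm x)\<^sup>2 * (norm v)\<^sup>2 / 2"
      unfolding sesq_mat trace_outer by simp
    \<comment> \<open>The form is at least -|D|^2 / 4, hence at least -|x|^2 |v|^2 / 2, which the
      multiple \<open>trace / 2\<close> of the identity compensates exactly.\<close>
    ultimately show ?thesis using D by (simp add: sesq_matrix_add)
  qed
  then show ?case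
    unfolding psd_iff using trace_psd_real[OF psd_outer[of x]]
    by (auto simp: mat_def partial_transpose_def outer_def Reals_cnj_iff)
next
  case (add M N)
  have "partial_transpose (M + N) + mat (trace (M + N) / 2)
      = (partial_transpose M + mat (trace M / 2)) + (partial_transpose N + mat (trace N / 2))"
    by (simp add: partial_transpose_def trace_add mat_add add_divide_distrib vec_eq_iff)
  with add show ?case by (simp add: psd_add)
qed

subsection \<open>Positivity on product states\<close>

lemma trace_tensor: "trace (tensor M N) = trace M * trace N"
  by (simp add: trace_def tensor_def sum_UNIV_prod sum_product)

text \<open>The identity term is split by writing Tr \<sigma> times the identity as \<sigma> plus
  the remainder. The part with \<sigma> gives each of the two partial transposes of \<tau> its share
  Tr \<tau> / 2.\<close>

lemma \<Phi>\<^sub>T_tensor: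
  fixes \<sigma> :: "'a::finite operator" and \<tau> :: "('b::finite \<times> 'c::finite) operator"
  shows "\<Phi>\<^sub>T 1 (tensor \<sigma> \<tau>) = tensor (transpose \<sigma>) \<tau>
    + tensor \<sigma> ((partial_transpose \<tau> + mat (trace \<tau> / 2))
        + transpose (partial_transpose \<tau> + mat (trace \<tau> / 2)))
    + tensor (mat (trace \<sigma>) - \<sigma>) (mat (trace \<tau>))"
  unfolding \<Phi>\<^sub>T_def trace_tensor
  by (auto simp: vec_eq_iff pt_A_def pt_B_def pt_C_def partial_transpose_def tensor_def transpose_def mat_def
      algebra_simps)

lemma psd_mat: "z \<in> \<real> \<Longrightarrow> 0 \<le> Re z \<Longrightarrow> psd (mat z)"
  unfolding psd_iff sesq_mat by (auto simp: mat_def Reals_cnj_iff)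

lemma psd_\<Phi>\<^sub>T_tensor:
  fixes \<sigma> :: "'a::finite operator" and \<tau> :: "('b::finite \<times> 'c::finite) operator"
  assumes "psd \<sigma>" "psd \<tau>" shows "psd (\<Phi>\<^sub>T 1 (tensor \<sigma> \<tau>))"
proof -
  have "0 \<le> Re (trace \<tau>)"
    unfolding trace_def using psd_diagonal(2)[OF assms(2)] by (simp add: sum_nonneg)
  then have "psd (mat (trace \<tau>) :: ('b \<times> 'c) operator)"
    using trace_psd_real[OF assms(2)] by (intro psd_mat)
  then show ?thesis
    unfolding \<Phi>\<^sub>T_tensor using assms
    by (intro psd_add psd_tensor psd_transpose psd_partial_transpose psd_trace_minus)
qed

lemma psd_\<Phi>\<^sub>T_product_B_AC:
  assumes "product_B_AC (\<rho> :: ('a::finite \<times> 'b::finite \<times> 'c::finite) operator)"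
  shows "psd (\<Phi>\<^sub>T 1 \<rho>)"
proof -
  obtain \<sigma> :: "'b operator" and \<tau> :: "('a \<times> 'c) operator" where \<rho>: "psd \<sigma>" "psd \<tau>"
    "\<rho> = (\<chi> i j. case (i, j) of ((a, b, c), (a', b', c')) \<Rightarrow>
      tensor \<sigma> \<tau> $ (b, (a, c)) $ (b', (a', c')))"
    using assms unfolding product_B_AC_def state_def by blast
  define f :: "'a \<times> 'b \<times> 'c \<Rightarrow> 'b \<times> 'a \<times> 'c" where "f = (\<lambda>(a, b, c). (b, a, c))"
  have "bij f"
    by (rule o_bij[of "\<lambda>(b, a, c). (a, b, c)"]) (auto simp: f_def fun_eq_iff)
  have "trace \<rho> = trace (tensor \<sigma> \<tau>)"
    unfolding trace_def sum_UNIV_bij[OF \<open>bij f\<close>, symmetric]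
    by (simp add: \<rho>(3) f_def split_def)
  then have "\<Phi>\<^sub>T 1 \<rho> = (\<chi> i j. \<Phi>\<^sub>T 1 (tensor \<sigma> \<tau>) $ f i $ f j)"
    unfolding \<Phi>\<^sub>T_def
    by (auto simp: vec_eq_iff pt_A_def pt_B_def pt_C_def \<rho>(3) f_def mat_def)
  then show ?thesis
    using psd_reindex[OF \<open>bij f\<close> psd_\<Phi>\<^sub>T_tensor[OF \<rho>(1,2)]] by simp
qed

lemma psd_\<Phi>\<^sub>T_product_C_AB:
  assumes "product_C_AB (\<rho> :: ('a::finite \<times> 'b::finite \<times> 'c::finite) operator)"
  shows "psd (\<Phi>\<^sub>T 1 \<rho>)"
proof -
  obtain \<sigma> :: "'c operator" and \<tau> :: "('a \<times> 'b) operator" where \<rho>: "psd \<sigma>" "psd \<tau>"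
    "\<rho> = (\<chi> i j. case (i, j) of ((a, b, c), (a', b', c')) \<Rightarrow>
      tensor \<sigma> \<tau> $ (c, (a, b)) $ (c', (a', b')))"
    using assms unfolding product_C_AB_def state_def by blast
  define f :: "'a \<times> 'b \<times> 'c \<Rightarrow> 'c \<times> 'a \<times> 'b" where "f = (\<lambda>(a, b, c). (c, a, b))"
  have "bij f"
    by (rule o_bij[of "\<lambda>(c, a, b). (a, b, c)"]) (auto simp: f_def fun_eq_iff)
  have "trace \<rho> = trace (tensor \<sigma> \<tau>)"
    unfolding trace_def sum_UNIV_bij[OF \<open>bij f\<close>, symmetric]
    by (simp add: \<rho>(3) f_def split_def)
  then have "\<Phi>\<^sub>T 1 \<rho> = (\<chi> i j. \<Phi>\<^sub>T 1 (tensor \<sigma> \<tau>) $ f i $ f j)"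
    unfolding \<Phi>\<^sub>T_def
    by (auto simp: vec_eq_iff pt_A_def pt_B_def pt_C_def \<rho>(3) f_def mat_def)
  then show ?thesis
    using psd_reindex[OF \<open>bij f\<close> psd_\<Phi>\<^sub>T_tensor[OF \<rho>(1,2)]] by simp
qed

text \<open>Real linearity is what passes positivity from product states to convex mixtures.\<close>

lemma linear_\<Phi>\<^sub>T: "linear (\<Phi>\<^sub>T c)"
proof (rule linearI)
  show "\<Phi>\<^sub>T c (\<rho> + \<rho>') = \<Phi>\<^sub>T c \<rho> + \<Phi>\<^sub>T c \<rho>'" for \<rho> \<rho>' :: "('a \<times> 'b \<times> 'c) operator"
    by (simp add: \<Phi>\<^sub>T_def pt_A_def pt_B_def pt_C_def mat_def trace_add vec_eq_iff algebra_simps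
        split: prod.splits)
  show "\<Phi>\<^sub>T c (r *\<^sub>R \<rho>) = r *\<^sub>R \<Phi>\<^sub>T c \<rho>" for r and \<rho> :: "('a \<times> 'b \<times> 'c) operator"
    by (simp add: \<Phi>\<^sub>T_def pt_A_def pt_B_def pt_C_def mat_def trace_def vec_eq_iff algebra_simps
        flip: scaleR_sum_right split: prod.splits)
qed

lemma psd_\<Phi>\<^sub>T_biseparable:
  assumes "biseparable \<rho>" shows "psd (\<Phi>\<^sub>T 1 \<rho>)"
proof -
  obtain n p \<sigma> where p: "\<And>k. k < n \<Longrightarrow> 0 \<le> p k \<and>
        (product_A_BC (\<sigma> k) \<or> product_B_AC (\<sigma> k) \<or> product_C_AB (\<sigma> k))"
    and \<rho>: "\<rho> = (\<Sum>k<n::nat. p k *\<^sub>R \<sigma> k)"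
    using assms unfolding biseparable_def by blast
  have "psd (\<Phi>\<^sub>T 1 (\<sigma> k))" if "k < n" for k
    using p[OF that]
    by (auto simp: product_A_BC_def state_def
        intro: psd_\<Phi>\<^sub>T_product_B_AC psd_\<Phi>\<^sub>T_product_C_AB psd_\<Phi>\<^sub>T_tensor)
  then show ?thesis
    unfolding \<rho> linear_sum[OF linear_\<Phi>\<^sub>T] linear_cmul[OF linear_\<Phi>\<^sub>T]
    using p by (intro psd_sum psd_scaleR) auto
qed

subsection \<open>Optimality\<close>

lemma product_imp_biseparable: "product_A_BC \<rho> \<Longrightarrow> biseparable \<rho>"
  unfolding biseparable_def
  by (intro exI[of _ "1::nat"] exI[of _ "\<lambda>_. 1"] exI[of _ "\<lambda>_. \<rho>"]) simp

lemma state_outer: "norm x = 1 \<Longrightarrow> state (outer x)"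
  by (simp add: state_def psd_outer trace_outer)

text \<open>The form is tested at e_i - e_j; with the indices \<open>e\<close> and \<open>f\<close>
  of the optimality proof this is the antisymmetric vector.\<close>

lemma psd_two_by_two:
  assumes "psd M" shows "0 \<le> Re (M $ i $ i + M $ j $ j - M $ i $ j - M $ j $ i)"
  using psd_nonneg[OF assms, of "axis i 1 - axis j 1"]
  by (simp add: sesq_diff_left sesq_diff_right sesq_axis_left matrix_vector_axis)

lemma norm_axis_add_axis:
  assumes "i \<noteq> j" shows "norm (axis i a + axis j b :: complex ^ 'n::finite) = sqrt ((cmod a)\<^sup>2 + (cmod b)\<^sup>2)"
proof -
  have "(\<Sum>k\<in>UNIV. (cmod ((axis i a + axis j b :: complex ^ 'n) $ k))\<^sup>2)
      = (\<Sum>k\<in>UNIV. (if k = i then (cmod a)\<^sup>2 else 0) + (if k = j then (cmod b)\<^sup>2 else 0))"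
    using assms by (intro sum.cong) (auto simp: axis_def)
  also have "\<dots> = (cmod a)\<^sup>2 + (cmod b)\<^sup>2"
    by (simp add: sum.distrib)
  finally show ?thesis by (simp add: norm_vec_def L2_set_def)
qed

lemma \<Phi>\<^sub>T_optimal:
  assumes B: "CARD('b::finite) \<ge> 2" and C: "CARD('c::finite) \<ge> 2"
    and pos: "\<And>\<rho> :: ('a::finite \<times> 'b \<times> 'c) operator. biseparable \<rho> \<Longrightarrow> psd (\<Phi>\<^sub>T c \<rho>)"
  shows "1 \<le> c"
proof -
  obtain b0 b1 :: 'b where b: "b0 \<noteq> b1"
    using B card_le_Suc0_iff_eq[of "UNIV :: 'b set"] by auto
  obtain c0 c1 :: 'c where c: "c0 \<noteq> c1"
    using C card_le_Suc0_iff_eq[of "UNIV :: 'c set"] by auto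
  define a0 :: 'a where "a0 = undefined"
  define \<psi> :: "complex ^ ('b \<times> 'c)"
    where "\<psi> = axis (b0, c0) (of_real (1 / sqrt 2)) + axis (b1, c1) (of_real (1 / sqrt 2))"
  \<comment> \<open>A basis state on A times the maximally entangled state of two levels of B and of
    C.\<close>
  define \<rho> where "\<rho> = tensor (outer (axis a0 1)) (outer \<psi>)"
  have "norm \<psi> = 1"
    using b unfolding \<psi>_def by (subst norm_axis_add_axis) (auto simp: norm_divide power_divide)
  then have st: "state (outer (axis a0 1))" "state (outer \<psi>)"
    by (auto intro!: state_outer simp: norm_axis_1)
  then have "product_A_BC \<rho>"
    unfolding product_A_BC_def \<rho>_def by blast
  then have psd: "psd (\<Phi>\<^sub>T c \<rho>)"
    by (intro pos product_imp_biseparable)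
  have tr: "trace \<rho> = 1"
    using st by (simp add: \<rho>_def trace_tensor state_def)
  have half: "complex_of_real (sqrt 2) * of_real (sqrt 2) = 2"
    by (simp flip: of_real_mult)
  define e where "e = (a0, b0, c1)"
  define f where "f = (a0, b1, c0)"
  \<comment> \<open>On the span of \<open>e\<close> and \<open>f\<close> the summand
    \<open>pt_A\<close> vanishes, while \<open>pt_B\<close> and \<open>pt_C\<close> each put 1/2 off
    the diagonal. The form at e - f is thus 2 c - 2.\<close>
  have "\<Phi>\<^sub>T c \<rho> $ e $ e = of_real c" "\<Phi>\<^sub>T c \<rho> $ f $ f = of_real c"
    "\<Phi>\<^sub>T c \<rho> $ e $ f = 1" "\<Phi>\<^sub>T c \<rho> $ f $ e = 1"
    unfolding \<Phi>\<^sub>T_def tr using b c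
    by (simp_all add: e_def f_def pt_A_def pt_B_def pt_C_def mat_def \<rho>_def tensor_def outer_def
        \<psi>_def axis_def half)
  then show ?thesis
    using psd_two_by_two[OF psd, of e f] by simp
qed

theorem theorem1:
  assumes "CARD('a::finite) \<ge> 2" and "CARD('b::finite) \<ge> 2" and "CARD('c::finite) \<ge> 2"
  shows "(\<forall>\<rho> :: ('a \<times> 'b \<times> 'c) operator. biseparable \<rho> \<longrightarrow> psd (\<Phi>\<^sub>T 1 \<rho>)) \<and>
    (\<forall>c::real. (\<forall>\<rho> :: ('a \<times> 'b \<times> 'c) operator. biseparable \<rho> \<longrightarrow> psd (\<Phi>\<^sub>T c \<rho>)) \<longrightarrow> 1 \<le> c)"
  using psd_\<Phi>\<^sub>T_biseparable \<Phi>\<^sub>T_optimal[OF assms(2,3)] by blast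

end
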